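(* Let $G\cong K_{A_1,\ldots,A_r}$ be a complete multipartite graph on $V=A_1\sqcup\cdots\sqcup A_r$, with $r\ge 2$. Then $G$ is Hall-universal if and only if $$|V|-\max_i|A_i|\le 2\qquad\text{or}\qquad 2\max_i|A_i|-|V|\le 2.$$
   Context: All graphs are finite and simple. For a finite set $V$, $\mathcal G(V)$ denotes the set of all finite simple undirected graphs with vertex set $V$, and $N_G(v)$ is the (open) neighborhood of $v$ in $G$. List coloring: for a graph $H$, a set of colors $S$ and $L:V(H)\to 2^S$, $H$ is $L$-colorable if there is a map $\varphi:V(H)\to S$ with $\varphi(v)\in L(v)$ for all $v$ and $\varphi(u)\ne\varphi(v)$ for every edge $uv\in E(H)$. For a subgraph $F$ of $H$ and $\sigma\in S$, $\alpha(F,L,\sigma)$ is the maximum size of an independent set $X\subseteq V(F)$ of $F$ with $\sigma\in L(v)$ for all $v\in X$. The pair $(H,L)$ satisfies Hall's condition if $|V(F)|\le\sum_{\sigma\in S}\alpha(F,L,\sigma)$ for every subgraph $F$ of $H$. Graphic lists: for $G,H\in\mathcal G(V)$, let $L(v)=N_G(v)$ for all $v\in V$ (with color set $S=V$). $H$ is $G$-colorable if $H$ is $L$-colorable, and $(H,G)$ satisfies Hall's condition if $(H,L)$ does. A graph $G\in\mathcal G(V)$ is Hall-universal if, for every $H\in\mathcal G(V)$ such that $(H,G)$ satisfies Hall's condition, $H$ is $G$-colorable. $K_{A_1,\ldots,A_r}$ is the complete multipartite graph with (nonempty) parts $A_1,\ldots,A_r$: two vertices are adjacent if and only if they lie in different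 parts. *)

theory Defs
  imports
    "Graph_Theory.Graph_Theory"
    "HOL-Library.FuncSet"
    "HOL-Library.Disjoint_Sets"
begin

text \<open>
  A finite simple undirected graph is a \<^locale>\<open>pair_graph\<close>: a finite vertex set with a symmetric
  irreflexive relation on it, so that an edge \<open>uv\<close> is present as both arcs \<open>(u, v)\<close> and \<open>(v, u)\<close>.
  On such graphs \<^const>\<open>digraph_iso\<close> is the usual graph isomorphism.
\<close>

definition graphs_on :: "'a set \<Rightarrow> 'a pair_pre_digraph set" where
  "graphs_on V = {G. pair_graph G \<and> pverts G = V}"

definition neighborhood :: "'a pair_pre_digraph \<Rightarrow> 'a \<Rightarrow> 'a set" where
  "neighborhood G v = {u. (v, u) \<in> parcs G}"

definition independent_set :: "'a pair_pre_digraph \<Rightarrow> 'a set \<Rightarrow> bool" where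
  "independent_set F X \<longleftrightarrow> X \<subseteq> pverts F \<and> (\<forall>u\<in>X. \<forall>v\<in>X. (u, v) \<notin> parcs F)"

definition list_colorable :: "'a pair_pre_digraph \<Rightarrow> 'c set \<Rightarrow> ('a \<Rightarrow> 'c set) \<Rightarrow> bool" where
  "list_colorable H S L \<longleftrightarrow>
     (\<exists>\<phi> \<in> pverts H \<rightarrow> S. (\<forall>v\<in>pverts H. \<phi> v \<in> L v) \<and> (\<forall>(u, v)\<in>parcs H. \<phi> u \<noteq> \<phi> v))"

text \<open>For finite \<open>F\<close> the maximum ranges over a finite set containing \<open>card {} = 0\<close>.\<close>

definition hall_alpha :: "'a pair_pre_digraph \<Rightarrow> ('a \<Rightarrow> 'c set) \<Rightarrow> 'c \<Rightarrow> nat" where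
  "hall_alpha F L \<sigma> = Max (card ` {X. independent_set F X \<and> (\<forall>v\<in>X. \<sigma> \<in> L v)})"

text \<open>
  Meant for a finite color set \<open>S\<close>. The library's \<^const>\<open>subgraph\<close> admits arbitrary subdigraphs,
  hence the additional requirement that \<open>F\<close> is itself undirected.
\<close>

definition hall_condition :: "'a pair_pre_digraph \<Rightarrow> 'c set \<Rightarrow> ('a \<Rightarrow> 'c set) \<Rightarrow> bool" where
  "hall_condition H S L \<longleftrightarrow>
     (\<forall>F. pair_graph F \<and> subgraph (with_proj F) (with_proj H) \<longrightarrow>
        card (pverts F) \<le> (\<Sum>\<sigma>\<in>S. hall_alpha F L \<sigma>))"

definition graph_colorable :: "'a pair_pre_digraph \<Rightarrow> 'a pair_pre_digraph \<Rightarrow> bool" where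
  "graph_colorable H G \<longleftrightarrow> list_colorable H (pverts G) (neighborhood G)"

definition graph_hall_condition :: "'a pair_pre_digraph \<Rightarrow> 'a pair_pre_digraph \<Rightarrow> bool" where
  "graph_hall_condition H G \<longleftrightarrow> hall_condition H (pverts G) (neighborhood G)"

definition hall_universal :: "'a pair_pre_digraph \<Rightarrow> bool" where
  "hall_universal G \<longleftrightarrow>
     (\<forall>H \<in> graphs_on (pverts G). graph_hall_condition H G \<longrightarrow> graph_colorable H G)"

definition complete_multipartite :: "'i set \<Rightarrow> ('i \<Rightarrow> 'a set) \<Rightarrow> 'a pair_pre_digraph" where
  "complete_multipartite I A =
     \<lparr> pverts = (\<Union>i\<in>I. A i),
       parcs = {(u, v). \<exists>i\<in>I. \<exists>j\<in>I. i \<noteq> j \<and> u \<in> A i \<and> v \<in> A j} \<rparr>"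

lemma complete_multipartite_in_graphs_on:
  assumes "finite (\<Union>i\<in>I. A i)" and "disjoint_family_on A I"
  shows "complete_multipartite I A \<in> graphs_on (\<Union>i\<in>I. A i)"
proof -
  let ?K = "complete_multipartite I A"
  have "parcs ?K \<subseteq> (\<Union>i\<in>I. A i) \<times> (\<Union>i\<in>I. A i)"
    by (auto simp: complete_multipartite_def)
  with assms(1) have "finite (parcs ?K)"
    by (meson finite_SigmaI finite_subset)
  moreover have "symmetric (with_proj ?K)"
    unfolding symmetric_def with_proj_simps
    by (rule symI) (simp add: complete_multipartite_def, metis)
  moreover have "fst e \<noteq> snd e" if "e \<in> parcs ?K" for e
    using that assms(2) unfolding complete_multipartite_def disjoint_family_on_def by fastforce
  ultimately have "pair_graph ?K"
    using assms(1) by unfold_locales (auto simp: complete_multipartite_def)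
  then show ?thesis
    by (simp add: graphs_on_def complete_multipartite_def)
qed

end

theory Submission
  imports Defs
begin

text \<open>
  Let \<open>A\<close> be a largest part of \<open>G\<close> and \<open>B = V - A\<close>, with \<open>b = |B|\<close>. The right-hand side of the
  equivalence says that \<open>b \<le> 2\<close> or \<open>|A| \<le> b + 2\<close>.

  If \<open>|A| \<le> b\<close>, then some permutation of \<open>V\<close> moves every vertex to another part; read as a coloring
  it uses every color once, hence is proper for every \<open>H\<close> (\<open>graph_colorable_if_no_large_part\<close>). If
  \<open>|A| \<ge> b\<close>, only \<open>H[A]\<close> matters. Every vertex of \<open>A\<close> has the list \<open>B\<close>, and the vertices of \<open>B\<close> can
  be given distinct colors from \<open>A\<close>, so \<open>H\<close> is \<open>G\<close>-colorable iff \<open>H[A]\<close> is \<open>b\<close>-colorable. Hall's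
  condition for the subgraphs of \<open>H[A]\<close> says that \<open>|F| \<le> b \<alpha>(F)\<close> for all \<open>F \<subseteq> A\<close>, that is, that \<open>H[A]\<close>
  has Hall ratio at most \<open>b\<close>; when \<open>H\<close> has no edges outside \<open>A\<close>, this is all of Hall's condition. The
  question is therefore for which \<open>b\<close> and \<open>|A|\<close> a Hall ratio of at most \<open>b\<close> forces
  \<open>b\<close>-colorability.

  It does so for \<open>b = 1\<close>, where \<open>A\<close> is stable, for \<open>b = 2\<close>, since odd cycles have Hall ratio greater
  than 2, and for \<open>|A| \<le> b + 2\<close>, where a nonadjacent pair saves one color and a stable triple or two
  disjoint nonadjacent pairs save two (\<open>k_colorable_if_hall_ratio_le\<close>). In all other cases \<open>b \<ge> 3\<close> and
  \<open>|A| \<ge> b + 3\<close>, and the join of a clique on \<open>b - 2\<close> vertices with a 5-cycle, padded with isolated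
  vertices, has Hall ratio at most \<open>b\<close> but chromatic number \<open>b + 1\<close>
  (\<open>ex_hall_ratio_le_not_colorable\<close>).
\<close>

section \<open>Colorings and the Hall ratio\<close>

text \<open>
  Edge sets are binary relations here, and the colors of a \<open>k\<close>-coloring are \<open>0, \<dots>, k - 1\<close>. In all
  three notions only the edges within the given vertex set count.
\<close>

definition stable_set :: "'a rel \<Rightarrow> 'a set \<Rightarrow> bool" where
  "stable_set E X \<longleftrightarrow> (\<forall>u\<in>X. \<forall>v\<in>X. (u, v) \<notin> E)"

definition k_colorable :: "'a rel \<Rightarrow> 'a set \<Rightarrow> nat \<Rightarrow> bool" where
  "k_colorable E A k \<longleftrightarrow>
     (\<exists>c::'a \<Rightarrow> nat. c ` A \<subseteq> {..<k} \<and> (\<forall>u\<in>A. \<forall>v\<in>A. (u, v) \<in> E \<longrightarrow> c u \<noteq> c v))"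

text \<open>
  The Hall ratio of a graph is the maximum of \<open>|F| / \<alpha>(F)\<close> over its nonempty induced subgraphs \<open>F\<close>.
  The bound is stated without the quotient and without the maximum.
\<close>

definition hall_ratio_le :: "'a rel \<Rightarrow> 'a set \<Rightarrow> nat \<Rightarrow> bool" where
  "hall_ratio_le E A k \<longleftrightarrow> (\<forall>F\<subseteq>A. \<exists>X\<subseteq>F. stable_set E X \<and> card F \<le> k * card X)"

lemma k_colorableI:
  assumes "finite (c ` A)" and "card (c ` A) \<le> k"
    and "\<And>u v. u \<in> A \<Longrightarrow> v \<in> A \<Longrightarrow> (u, v) \<in> E \<Longrightarrow> c u \<noteq> c v"
  shows "k_colorable E A k"
proof -
  obtain h :: "_ \<Rightarrow> nat" where h: "bij_betw h (c ` A) {0..<card (c ` A)}"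
    using assms(1) ex_bij_betw_finite_nat by blast
  have "h (c x) < k" if "x \<in> A" for x
    using that assms(2) bij_betwE[OF h] by fastforce
  moreover have "h (c u) \<noteq> h (c v)" if "u \<in> A" "v \<in> A" "(u, v) \<in> E" for u v
    using assms(3)[OF that] that bij_betw_imp_inj_on[OF h] by (auto dest: inj_onD)
  ultimately show ?thesis
    unfolding k_colorable_def by (intro exI[of _ "h \<circ> c"]) auto
qed

lemma hall_ratio_le_nonadjacent:
  assumes "hall_ratio_le E A k" and "F \<subseteq> A" and "k < card F"
  obtains u v where "u \<in> F" "v \<in> F" "u \<noteq> v" "(u, v) \<notin> E" "(v, u) \<notin> E"
proof -
  obtain X where X: "X \<subseteq> F" "stable_set E X" "card F \<le> k * card X"
    using assms(1,2) unfolding hall_ratio_le_def by meson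
  have "\<not> card X \<le> 1"
  proof
    assume "card X \<le> 1"
    then have "k * card X \<le> k * 1"
      by (rule mult_le_mono2)
    with X(3) assms(3) show False by simp
  qed
  then obtain u v where "u \<in> X" "v \<in> X" "u \<noteq> v"
    by (metis One_nat_def card_le_Suc0_iff_eq card.infinite zero_le_one)
  with X(1,2) that show ?thesis
    unfolding stable_set_def by blast
qed

section \<open>Two colors: odd cycles\<close>

lemma sym_relpow:
  assumes "sym R"
  shows "(x, y) \<in> R ^^ n \<longleftrightarrow> (y, x) \<in> R ^^ n"
proof -
  have "(y, x) \<in> R ^^ n" if "(x, y) \<in> R ^^ n" for x y
    using that
  proof (induction n arbitrary: y)
    case (Suc n)
    then obtain z where "(x, z) \<in> R ^^ n" "(z, y) \<in> R"
      by auto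
    with Suc.IH assms show ?case
      by (meson relpow_Suc_I2 symD)
  qed simp
  then show ?thesis by blast
qed

lemma relpow_trans: "(x, y) \<in> R ^^ m \<Longrightarrow> (y, z) \<in> R ^^ n \<Longrightarrow> (x, z) \<in> R ^^ (m + n)"
  by (auto simp: relpow_add)

lemma relpow_segment:
  assumes "\<forall>i<n. (f i, f (Suc i)) \<in> R" and "i \<le> j" and "j \<le> n"
  shows "(f i, f j) \<in> R ^^ (j - i)"
  unfolding relpow_fun_conv
  using assms by (intro exI[of _ "\<lambda>l. f (i + l)"]) auto

text \<open>Without odd closed walks, all walks to a vertex from the representative of its component have
  the same parity, and coloring each vertex by this parity is proper.\<close>

lemma two_colorable_if_no_odd_closed_walk:
  assumes "sym R" and no_odd: "\<And>x n. odd n \<Longrightarrow> (x, x) \<notin> R ^^ n"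
  obtains c :: "'a \<Rightarrow> bool" where "\<And>u v. (u, v) \<in> R \<Longrightarrow> c u \<noteq> c v"
proof -
  define rep where "rep v = (SOME x. (x, v) \<in> R\<^sup>*)" for v
  define c where "c v \<longleftrightarrow> (\<exists>n. even n \<and> (rep v, v) \<in> R ^^ n)" for v
  have "c u \<noteq> c v" if uv: "(u, v) \<in> R" for u v
  proof -
    have vu: "(v, u) \<in> R"
      using assms(1) uv by (meson symD)
    have "(x, u) \<in> R\<^sup>* \<longleftrightarrow> (x, v) \<in> R\<^sup>*" for x
      using uv vu by (meson rtrancl.rtrancl_into_rtrancl)
    then have rep: "rep v = rep u"
      by (simp add: rep_def)
    have "(rep u, u) \<in> R\<^sup>*"
      unfolding rep_def by (rule someI[of _ u]) simp
    then obtain n where n: "(rep u, u) \<in> R ^^ n"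
      by (auto dest: rtrancl_imp_relpow)
    show ?thesis
    proof
      assume eq: "c u = c v"
      show False
      proof (cases "c u")
        case True
        with eq rep obtain k l where k: "even k" "(rep u, u) \<in> R ^^ k"
          and l: "even l" "(rep u, v) \<in> R ^^ l"
          unfolding c_def by metis
        have "(v, rep u) \<in> R ^^ l"
          using l(2) sym_relpow[OF assms(1)] by blast
        moreover have "(rep u, v) \<in> R ^^ Suc k"
          using k(2) uv by (rule relpow_Suc_I)
        ultimately have "(v, v) \<in> R ^^ (l + Suc k)"
          by (rule relpow_trans)
        with no_odd[of "l + Suc k" v] k(1) l(1) show False by simp
      next
        case False
        with n have "odd n"
          unfolding c_def by blast
        moreover have "(rep v, v) \<in> R ^^ Suc n"
          unfolding rep using n uv by (rule relpow_Suc_I)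
        ultimately have "c v"
          unfolding c_def by (intro exI[of _ "Suc n"]) simp
        with False eq show False by simp
      qed
    qed
  qed
  then show ?thesis by (rule that)
qed

text \<open>A shortest odd closed walk is a cycle, and a stable set \<open>X\<close> in a cycle is disjoint from its
  shift by one step, so that it contains fewer than half of the vertices.\<close>

lemma two_colorable_if_hall_ratio_le_2:
  assumes "finite A" and "sym E" and "hall_ratio_le E A 2"
  shows "k_colorable E A 2"
proof -
  define R where "R = E \<inter> A \<times> A"
  have symR: "sym R"
    using assms(2) unfolding R_def sym_def by blast
  have no_odd: "(x, x) \<notin> R ^^ n" if odd: "odd n" for x n
    using odd
  proof (induction n arbitrary: x rule: less_induct)
    case (less n)
    show ?case
    proof
      assume "(x, x) \<in> R ^^ n"
      then obtain f where f: "f 0 = x" "f n = x" "\<forall>i<n. (f i, f (Suc i)) \<in> R"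
        unfolding relpow_fun_conv by blast
      have npos: "0 < n"
        using less.prems by (rule odd_pos)
      \<comment> \<open>A repeated vertex would split the walk into two shorter closed walks, one of them odd.\<close>
      have neq: "f i \<noteq> f j" if ij: "i < j" "j < n" for i j
      proof
        assume eq: "f i = f j"
        have "(f i, f i) \<in> R ^^ (j - i)"
          using relpow_segment[OF f(3), of i j] ij eq by simp
        moreover have "j - i < n"
          using ij by simp
        ultimately have ev: "even (j - i)"
          using less.IH by blast
        have "(f 0, f i) \<in> R ^^ (i - 0)" "(f j, f n) \<in> R ^^ (n - j)"
          using relpow_segment[OF f(3), of 0 i] relpow_segment[OF f(3), of j n] ij by simp_all
        then have "(x, x) \<in> R ^^ (i + (n - j))"
          using f(1,2) eq relpow_trans[of x "f i" i R x "n - j"] by simp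
        moreover have "odd (i + (n - j))"
          using ev ij less.prems by presburger
        moreover have "i + (n - j) < n"
          using ij by simp
        ultimately show False
          using less.IH by blast
      qed
      have inj: "inj_on f {..<n}"
        by (rule inj_onI) (metis lessThan_iff linorder_neqE_nat neq)
      have sub: "f ` {..<n} \<subseteq> A"
        using f(3) unfolding R_def by auto
      obtain X where X: "X \<subseteq> f ` {..<n}" "stable_set E X" "card (f ` {..<n}) \<le> 2 * card X"
        using assms(3) sub unfolding hall_ratio_le_def by meson
      define I where "I = {i. i < n \<and> f i \<in> X}"
      define s where "s i = Suc i mod n" for i
      have "f ` I = X"
        using X(1) unfolding I_def by auto
      moreover have "inj_on f I"
        using inj by (rule inj_on_subset) (auto simp: I_def)
      ultimately have cI: "card I = card X"
        by (metis card_image)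
      have I_sub: "I \<subseteq> {..<n}"
        unfolding I_def by auto
      have sn: "s i < n" if "i < n" for i
        using npos unfolding s_def by simp
      have s_cases: "s i = (if Suc i = n then 0 else Suc i)" if "i < n" for i
        using that unfolding s_def by auto
      have "inj_on s {..<n}"
        by (rule inj_onI) (auto simp: s_cases split: if_splits)
      then have "card (s ` I) = card I"
        using I_sub by (meson card_image inj_on_subset)
      moreover have "I \<inter> s ` I = {}"
      proof (rule ccontr)
        assume "I \<inter> s ` I \<noteq> {}"
        then obtain i where i: "i \<in> I" "s i \<in> I" by blast
        then have "i < n" unfolding I_def by simp
        moreover have "f (s i) = f (Suc i)"
          using s_cases[OF \<open>i < n\<close>] f(1,2) by auto
        ultimately have "(f i, f (s i)) \<in> E"
          using f(3) unfolding R_def by auto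
        moreover have "f i \<in> X" "f (s i) \<in> X"
          using i unfolding I_def by auto
        ultimately show False
          using X(2) unfolding stable_set_def by blast
      qed
      moreover have "finite I"
        using I_sub finite_subset by blast
      moreover have "card (I \<union> s ` I) \<le> card {..<n}"
        using I_sub sn by (intro card_mono) auto
      ultimately have "2 * card I \<le> n"
        by (simp add: card_Un_disjoint)
      with X(3) cI card_image[OF inj] have "n = 2 * card X" by simp
      with less.prems show False by simp
    qed
  qed
  obtain c :: "'a \<Rightarrow> bool" where c: "\<And>u v. (u, v) \<in> R \<Longrightarrow> c u \<noteq> c v"
    using two_colorable_if_no_odd_closed_walk[OF symR no_odd] by blast
  show ?thesis
  proof (rule k_colorableI)
    show "finite (c ` A)" by simp
    have "card (c ` A) \<le> card (UNIV :: bool set)"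
      by (rule card_mono) auto
    then show "card (c ` A) \<le> 2" by simp
    show "c u \<noteq> c v" if "u \<in> A" "v \<in> A" "(u, v) \<in> E" for u v
      using c that unfolding R_def by blast
  qed
qed

section \<open>Small Hall ratio forces colorability\<close>

text \<open>Color the vertices by themselves, except that one vertex of each nonadjacent pair takes the
  color of the other.\<close>

lemma k_colorable_merge_two_pairs:
  assumes "finite A" and "sym E" and "irrefl E" and "card A \<le> k + 2"
    and "{u, v, x, y} \<subseteq> A" and "distinct [u, v, x, y]" and "(u, v) \<notin> E" and "(x, y) \<notin> E"
  shows "k_colorable E A k"
proof (rule k_colorableI[where c = "id(v := u, y := x)"])
  have "id(v := u, y := x) ` A \<subseteq> A - {v, y}"
    using assms(5,6) by auto
  then have "card (id(v := u, y := x) ` A) \<le> card (A - {v, y})"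
    using assms(1) by (intro card_mono) auto
  also have "\<dots> = card A - 2"
    using assms(1,5,6) by (subst card_Diff_subset) auto
  finally show "card (id(v := u, y := x) ` A) \<le> k"
    using assms(4) by simp
qed (use assms in \<open>auto simp: irrefl_def dest: symD\<close>)

lemma k_colorable_merge_triple:
  assumes "finite A" and "sym E" and "irrefl E" and "card A \<le> k + 2"
    and "{u, v, w} \<subseteq> A" and "distinct [u, v, w]"
    and "(u, v) \<notin> E" and "(v, w) \<notin> E" and "(u, w) \<notin> E"
  shows "k_colorable E A k"
proof (rule k_colorableI[where c = "id(v := u, w := u)"])
  have "id(v := u, w := u) ` A \<subseteq> A - {v, w}"
    using assms(5,6) by auto
  then have "card (id(v := u, w := u) ` A) \<le> card (A - {v, w})"
    using assms(1) by (intro card_mono) auto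
  also have "\<dots> = card A - 2"
    using assms(1,5,6) by (subst card_Diff_subset) auto
  finally show "card (id(v := u, w := u) ` A) \<le> k"
    using assms(4) by simp
qed (use assms in \<open>auto simp: irrefl_def dest: symD\<close>)

text \<open>The critical case is \<open>|A| = k + 2\<close>. If neither two disjoint nonadjacent pairs nor a stable triple exist, then the nonadjacent pairs
  have a common vertex, whose removal leaves a clique of more than \<open>k\<close> vertices.\<close>

lemma k_colorable_if_card_le:
  assumes "finite A" and "sym E" and "irrefl E" and "hall_ratio_le E A k" and "card A \<le> k + 2"
  shows "k_colorable E A k"
proof -
  note merge2 = k_colorable_merge_two_pairs[OF assms(1-3,5)]
  note merge3 = k_colorable_merge_triple[OF assms(1-3,5)]
  consider "card A \<le> k" | "card A = k + 1" | "card A = k + 2"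
    using assms(5) by linarith
  then show ?thesis
  proof cases
    case 1
    then show ?thesis
      using assms(1,3) by (intro k_colorableI[where c = id]) (auto simp: irrefl_def)
  next
    case 2
    then obtain u v where uv: "u \<in> A" "v \<in> A" "u \<noteq> v" "(u, v) \<notin> E" "(v, u) \<notin> E"
      using hall_ratio_le_nonadjacent[OF assms(4) order_refl] by auto
    show ?thesis
    proof (rule k_colorableI[where c = "id(v := u)"])
      have "card (id(v := u) ` A) \<le> card (A - {v})"
        using assms(1) uv by (intro card_mono) auto
      then show "card (id(v := u) ` A) \<le> k"
        using 2 uv assms(1) by simp
    qed (use assms uv in \<open>auto simp: irrefl_def dest: symD\<close>)
  next
    case 3
    have remove: "\<exists>s\<in>A. \<exists>t\<in>A. s \<noteq> z \<and> t \<noteq> z \<and> s \<noteq> t \<and> (s, t) \<notin> E \<and> (t, s) \<notin> E"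
      if "z \<in> A" for z
    proof -
      have "k < card (A - {z})"
        using 3 that assms(1) by simp
      then obtain s t where "s \<in> A - {z}" "t \<in> A - {z}" "s \<noteq> t" "(s, t) \<notin> E" "(t, s) \<notin> E"
        using hall_ratio_le_nonadjacent[OF assms(4), of "A - {z}"] by blast
      then show ?thesis by blast
    qed
    obtain u v where uv: "u \<in> A" "v \<in> A" "u \<noteq> v" "(u, v) \<notin> E" "(v, u) \<notin> E"
      using 3 hall_ratio_le_nonadjacent[OF assms(4) order_refl] by auto
    obtain x y where xy: "x \<in> A" "y \<in> A" "x \<noteq> u" "y \<noteq> u" "x \<noteq> y" "(x, y) \<notin> E" "(y, x) \<notin> E"
      using remove[OF uv(1)] by blast
    show ?thesis
    proof (cases "x = v \<or> y = v")
      case False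
      then show ?thesis
        using uv xy by (intro merge2[of u v x y]) auto
    next
      case True
      then obtain w where w: "w \<in> A" "w \<noteq> u" "w \<noteq> v" "(v, w) \<notin> E" "(w, v) \<notin> E"
        using xy by blast
      obtain s t where st: "s \<in> A" "t \<in> A" "s \<noteq> v" "t \<noteq> v" "s \<noteq> t" "(s, t) \<notin> E" "(t, s) \<notin> E"
        using remove[OF uv(2)] by blast
      \<comment> \<open>Now \<open>{u, v}\<close>, \<open>{v, w}\<close> and \<open>{s, t}\<close> are nonadjacent pairs, the last one without \<open>v\<close>.\<close>
      consider "u \<notin> {s, t}" | "w \<notin> {s, t}" | "{s, t} = {u, w}"
        using w(2) by blast
      then show ?thesis
      proof cases
        case 1
        then show ?thesis
          using uv st by (intro merge2[of u v s t]) auto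
      next
        case 2
        then show ?thesis
          using uv(2) w st by (intro merge2[of v w s t]) auto
      next
        case 3
        then have "(u, w) \<notin> E"
          using st by (auto simp: doubleton_eq_iff)
        then show ?thesis
          using uv w by (intro merge3[of u v w]) auto
      qed
    qed
  qed
qed

lemma k_colorable_if_hall_ratio_le:
  assumes "finite A" and "sym E" and "irrefl E" and "hall_ratio_le E A k"
    and "0 < k" and "k \<le> 2 \<or> card A \<le> k + 2"
  shows "k_colorable E A k"
proof (cases "card A \<le> k + 2")
  case True
  then show ?thesis
    using assms k_colorable_if_card_le by blast
next
  case False
  then consider "k = 1" | "k = 2"
    using assms(5,6) by linarith
  then show ?thesis
  proof cases
    case 1
    obtain X where X: "X \<subseteq> A" "stable_set E X" "card A \<le> k * card X"
      using assms(4) unfolding hall_ratio_le_def by blast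
    then have "X = A"
      using 1 assms(1) by (simp add: card_seteq)
    then show ?thesis
      using X(2) 1 unfolding k_colorable_def stable_set_def by auto
  next
    case 2
    then show ?thesis
      using assms two_colorable_if_hall_ratio_le_2 by blast
  qed
qed

section \<open>A graph whose chromatic number exceeds its Hall ratio\<close>

text \<open>The join of a clique on \<open>b - 2\<close> vertices with the 5-cycle formed by the vertices \<open>0, \<dots>, 4\<close>,
  for \<open>b \<ge> 2\<close>.\<close>

definition join_C5 :: "nat \<Rightarrow> nat rel" where
  "join_C5 b = {(i, j). i < b + 3 \<and> j < b + 3 \<and> i \<noteq> j \<and>
     (i < 5 \<and> j < 5 \<longrightarrow> Suc i mod 5 = j \<or> Suc j mod 5 = i)}"

lemma sym_join_C5: "sym (join_C5 b)" and irrefl_join_C5: "irrefl (join_C5 b)"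
  by (auto simp: join_C5_def sym_def irrefl_def)

lemma join_C5_hall_ratio:
  assumes "3 \<le> b"
  shows "hall_ratio_le (join_C5 b) {..<b + 3} b"
  unfolding hall_ratio_le_def
proof (intro allI impI)
  fix F assume F: "F \<subseteq> {..<b + 3}"
  then have fin: "finite F"
    using finite_subset by blast
  consider "F = {}" | "F \<noteq> {}" "card F \<le> b" | "b < card F"
    by linarith
  then show "\<exists>X\<subseteq>F. stable_set (join_C5 b) X \<and> card F \<le> b * card X"
  proof cases
    case 1
    then show ?thesis by (auto simp: stable_set_def)
  next
    case 2
    then obtain v where "v \<in> F" by blast
    with 2 show ?thesis
      by (intro exI[of _ "{v}"]) (auto simp: stable_set_def join_C5_def)
  next
    case 3
    have "card F \<le> b + 3"
      using card_mono[OF _ F] by simp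
    also have "\<dots> \<le> b * 2"
      using assms by simp
    finally have le: "card F \<le> b * 2" .
    \<comment> \<open>\<open>F\<close> misses at most two of the \<open>b + 3\<close> vertices, hence it contains three vertices of the cycle.\<close>
    have "card F \<le> card (F \<inter> {..<5}) + card {5..<b + 3}"
    proof -
      have "F \<subseteq> (F \<inter> {..<5}) \<union> {5..<b + 3}"
        using F by auto
      then have "card F \<le> card ((F \<inter> {..<5}) \<union> {5..<b + 3})"
        by (intro card_mono) auto
      also have "\<dots> \<le> card (F \<inter> {..<5}) + card {5..<b + 3}"
        by (rule card_Un_le)
      finally show ?thesis .
    qed
    then have three: "3 \<le> card (F \<inter> {..<5})"
      using 3 assms by simp
    have edge: "\<not> F \<inter> {..<5} \<subseteq> {i, j}" for i j
    proof
      assume "F \<inter> {..<5} \<subseteq> {i, j}"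
      then have "card (F \<inter> {..<5}) \<le> card {i, j}"
        by (intro card_mono) auto
      also have "\<dots> \<le> 2"
        by (simp add: card_insert_if)
      finally show False
        using three by simp
    qed
    have cyc: "{..<5::nat} = {0, 1, 2, 3, 4}"
      by auto
    have "{0, 2} \<subseteq> F \<or> {1, 3} \<subseteq> F \<or> {2, 4} \<subseteq> F \<or> {0, 3} \<subseteq> F \<or> {1, 4} \<subseteq> F"
      using edge[of 0 1] edge[of 1 2] edge[of 2 3] edge[of 3 4] edge[of 4 0]
      unfolding cyc by auto
    then obtain i j where ij: "{i, j} \<subseteq> F" "(i, j) \<in> {(0, 2), (1, 3), (2, 4), (0, 3), (1, 4)}"
      by blast
    then have "card {i, j} = 2" "stable_set (join_C5 b) {i, j}"
      by (auto simp: stable_set_def join_C5_def)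
    with ij le show ?thesis
      by (intro exI[of _ "{i, j}"]) simp
  qed
qed

text \<open>The clique and the cycle use disjoint sets of \<open>b - 2\<close> and at least three colors.\<close>

lemma join_C5_not_colorable:
  assumes "2 \<le> b"
  shows "\<not> k_colorable (join_C5 b) {..<b + 3} b"
proof
  assume "k_colorable (join_C5 b) {..<b + 3} b"
  then obtain c :: "nat \<Rightarrow> nat" where range: "c ` {..<b + 3} \<subseteq> {..<b}"
    and "\<forall>u\<in>{..<b + 3}. \<forall>v\<in>{..<b + 3}. (u, v) \<in> join_C5 b \<longrightarrow> c u \<noteq> c v"
    unfolding k_colorable_def by blast
  then have proper: "c u \<noteq> c v" if "(u, v) \<in> join_C5 b" for u v
    using that unfolding join_C5_def by auto
  have "inj_on c {5..<b + 3}"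
    by (rule inj_onI, rule ccontr) (use proper in \<open>auto simp: join_C5_def\<close>)
  then have clique: "card (c ` {5..<b + 3}) = b - 2"
    by (simp add: card_image)
  have "c 0 \<noteq> c 1" "c 1 \<noteq> c 2" "c 2 \<noteq> c 3" "c 3 \<noteq> c 4" "c 4 \<noteq> c 0"
    using assms by (auto intro!: proper simp: join_C5_def)
  then have "card {c 0, c 1, c 2} = 3 \<or> card {c 0, c 3, c 4} = 3"
    by (cases "c 0 = c 2") auto
  moreover have "card {c 0, c 1, c 2} \<le> card (c ` {..<5})" "card {c 0, c 3, c 4} \<le> card (c ` {..<5})"
    by (intro card_mono; auto)+
  ultimately have cycle: "3 \<le> card (c ` {..<5})"
    by linarith
  have "c i \<noteq> c j" if "i < 5" "j \<in> {5..<b + 3}" for i j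
    using that assms by (intro proper) (auto simp: join_C5_def)
  then have "c ` {..<5} \<inter> c ` {5..<b + 3} = {}"
    by auto
  then have "card (c ` {..<5} \<union> c ` {5..<b + 3}) = card (c ` {..<5}) + card (c ` {5..<b + 3})"
    by (intro card_Un_disjoint) auto
  moreover have "c ` {..<5} \<union> c ` {5..<b + 3} \<subseteq> {..<b}"
    using range assms by (auto simp: image_subset_iff)
  then have "card (c ` {..<5} \<union> c ` {5..<b + 3}) \<le> b"
    using card_mono[of "{..<b}"] by fastforce
  ultimately show False
    using clique cycle assms by linarith
qed

text \<open>Adding isolated vertices preserves both properties.\<close>

lemma ex_hall_ratio_le_not_colorable:
  fixes A :: "'a set"
  assumes "finite A" and "3 \<le> b" and "b + 3 \<le> card A"
  obtains E where "E \<subseteq> A \<times> A" "sym E" "irrefl E" "hall_ratio_le E A b" "\<not> k_colorable E A b"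
proof -
  obtain C where C: "C \<subseteq> A" "card C = b + 3"
    using assms(3) by (meson obtain_subset_with_card_n)
  then have finC: "finite C"
    using assms(1) finite_subset by blast
  obtain g where g: "bij_betw g C {..<b + 3}"
    using finC C(2) by (metis atLeast0LessThan ex_bij_betw_finite_nat)
  define E where "E = {(u, v). u \<in> C \<and> v \<in> C \<and> (g u, g v) \<in> join_C5 b}"
  have ratio: "hall_ratio_le E A b"
    unfolding hall_ratio_le_def
  proof (intro allI impI)
    fix F assume F: "F \<subseteq> A"
    then have finF: "finite F"
      using assms(1) finite_subset by blast
    have "g ` (F \<inter> C) \<subseteq> {..<b + 3}"
      using bij_betwE[OF g] by auto
    then obtain Y where Y: "Y \<subseteq> g ` (F \<inter> C)" "stable_set (join_C5 b) Y"
        "card (g ` (F \<inter> C)) \<le> b * card Y"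
      using join_C5_hall_ratio[OF assms(2)] unfolding hall_ratio_le_def by meson
    define Z where "Z = {v \<in> F \<inter> C. g v \<in> Y}"
    have inj: "inj_on g (F \<inter> C)"
      using bij_betw_imp_inj_on[OF g] by (rule inj_on_subset) simp
    have "g ` Z = Y"
      using Y(1) unfolding Z_def by auto
    moreover have "inj_on g Z"
      using inj by (rule inj_on_subset) (auto simp: Z_def)
    ultimately have cZ: "card Z = card Y"
      by (metis card_image)
    have "card F = card (F \<inter> C) + card (F - C)"
      using finF by (metis card_Int_Diff)
    also have "\<dots> \<le> b * card Z + b * card (F - C)"
      using Y(3) cZ card_image[OF inj] assms(2) by (intro add_mono) auto
    also have "\<dots> = b * card (Z \<union> (F - C))"
      using finF by (subst card_Un_disjoint) (auto simp: Z_def algebra_simps)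
    finally have "card F \<le> b * card (Z \<union> (F - C))" .
    moreover have "stable_set E (Z \<union> (F - C))"
      using Y(2) unfolding stable_set_def E_def Z_def by auto
    ultimately show "\<exists>X\<subseteq>F. stable_set E X \<and> card F \<le> b * card X"
      by (intro exI[of _ "Z \<union> (F - C)"]) (auto simp: Z_def)
  qed
  have "\<not> k_colorable E A b"
  proof
    assume "k_colorable E A b"
    then obtain c :: "'a \<Rightarrow> nat" where c: "c ` A \<subseteq> {..<b}" "\<forall>u\<in>A. \<forall>v\<in>A. (u, v) \<in> E \<longrightarrow> c u \<noteq> c v"
      unfolding k_colorable_def by blast
    define h where "h = inv_into C g"
    have h: "h i \<in> C" "g (h i) = i" if "i < b + 3" for i
      using g that unfolding h_def bij_betw_def
      by (auto intro: inv_into_into f_inv_into_f)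
    have "k_colorable (join_C5 b) {..<b + 3} b"
      unfolding k_colorable_def
    proof (intro exI[of _ "c \<circ> h"] conjI ballI impI)
      show "(c \<circ> h) ` {..<b + 3} \<subseteq> {..<b}"
        using c(1) C(1) h(1) by fastforce
    next
      fix i j assume "i \<in> {..<b + 3}" "j \<in> {..<b + 3}" "(i, j) \<in> join_C5 b"
      then have "(h i, h j) \<in> E" "h i \<in> A" "h j \<in> A"
        using h C(1) unfolding E_def by auto
      with c(2) show "(c \<circ> h) i \<noteq> (c \<circ> h) j" by simp
    qed
    with join_C5_not_colorable assms(2) show False by simp
  qed
  moreover have "E \<subseteq> A \<times> A" "sym E" "irrefl E"
    using C(1) sym_join_C5[of b] irrefl_join_C5[of b]
    unfolding E_def sym_def irrefl_def by auto
  ultimately show ?thesis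
    using that ratio by blast
qed

section \<open>List colorings from a complete multipartite graph\<close>

lemma graphs_onD:
  assumes "H \<in> graphs_on V"
  shows "pverts H = V" "finite V" "parcs H \<subseteq> V \<times> V" "sym (parcs H)" "irrefl (parcs H)"
proof -
  interpret pair_graph H
    using assms unfolding graphs_on_def by simp
  show V: "pverts H = V"
    using assms unfolding graphs_on_def by simp
  show "finite V"
    using pair_finite_verts V by simp
  show "parcs H \<subseteq> V \<times> V"
    using in_arcsD1 in_arcsD2 V by auto
  show "sym (parcs H)"
    using pair_sym_arcs unfolding symmetric_def by simp
  show "irrefl (parcs H)"
    using pair_no_loops unfolding irrefl_def by fastforce
qed

lemma graphs_onI:
  assumes "finite V" and "E \<subseteq> V \<times> V" and "sym E" and "irrefl E"
  shows "\<lparr> pverts = V, parcs = E \<rparr> \<in> graphs_on V"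
proof -
  have "finite E"
    using assms(1,2) by (meson finite_SigmaI finite_subset)
  moreover have "fst e \<noteq> snd e" if "e \<in> E" for e
    using that assms(4) by (metis irrefl_def prod.collapse)
  ultimately have "pair_graph \<lparr> pverts = V, parcs = E \<rparr>"
    using assms(1-3) by unfold_locales (auto simp: symmetric_def)
  then show ?thesis
    unfolding graphs_on_def by simp
qed

lemma subgraph_with_projD:
  assumes "subgraph (with_proj F) (with_proj H)"
  shows "pverts F \<subseteq> pverts H" "parcs F \<subseteq> parcs H"
  using assms unfolding subgraph_def by auto

lemma induced_subgraph_of_graph:
  assumes "H \<in> graphs_on V" and "F \<subseteq> V"
  defines "K \<equiv> \<lparr> pverts = F, parcs = parcs H \<inter> F \<times> F \<rparr>"
  shows "pair_graph K \<and> subgraph (with_proj K) (with_proj H)"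
proof -
  note H = graphs_onD[OF assms(1)]
  have "K \<in> graphs_on F"
    unfolding K_def
  proof (rule graphs_onI)
    show "finite F"
      using assms(2) H(2) finite_subset by blast
    show "sym (parcs H \<inter> F \<times> F)" "irrefl (parcs H \<inter> F \<times> F)"
      using H(4,5) unfolding sym_def irrefl_def by blast+
  qed simp
  then have K: "pair_graph K"
    unfolding graphs_on_def by simp
  have Hg: "pair_graph H"
    using assms(1) unfolding graphs_on_def by simp
  have "wf_digraph (with_proj K)" "wf_digraph (with_proj H)"
    using graphs_onD(1,3)[OF \<open>K \<in> graphs_on F\<close>] H(1,3) by (unfold_locales; force)+
  then have "subgraph (with_proj K) (with_proj H)"
    using assms(2) H(1) unfolding subgraph_def K_def compatible_def by auto
  with K show ?thesis by blast
qed

lemma finite_hall_alpha_sets: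
  assumes "finite (pverts F)"
  shows "finite {X. independent_set F X \<and> (\<forall>v\<in>X. \<sigma> \<in> L v)}"
  by (rule finite_subset[of _ "Pow (pverts F)"]) (use assms in \<open>auto simp: independent_set_def\<close>)

lemma hall_alpha_ge:
  assumes "finite (pverts F)" and "independent_set F X" and "\<forall>v\<in>X. \<sigma> \<in> L v"
  shows "card X \<le> hall_alpha F L \<sigma>"
  unfolding hall_alpha_def
  using assms(2,3) by (intro Max_ge finite_imageI finite_hall_alpha_sets assms(1)) auto

lemma hall_alpha_le:
  assumes "finite (pverts F)"
    and "\<And>X. independent_set F X \<Longrightarrow> \<forall>v\<in>X. \<sigma> \<in> L v \<Longrightarrow> card X \<le> m"
  shows "hall_alpha F L \<sigma> \<le> m"
  unfolding hall_alpha_def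
proof (rule Max.boundedI)
  show "finite (card ` {X. independent_set F X \<and> (\<forall>v\<in>X. \<sigma> \<in> L v)})"
    by (intro finite_imageI finite_hall_alpha_sets assms(1))
  have "{} \<in> {X. independent_set F X \<and> (\<forall>v\<in>X. \<sigma> \<in> L v)}"
    by (simp add: independent_set_def)
  then show "card ` {X. independent_set F X \<and> (\<forall>v\<in>X. \<sigma> \<in> L v)} \<noteq> {}"
    by blast
qed (use assms(2) in auto)

text \<open>A complete multipartite graph on \<open>V\<close>, encoded by a function \<open>p\<close> whose fibres are the parts.
  The set \<open>A\<close> is one distinguished part; it may also be empty.\<close>

locale multipartite_part =
  fixes V :: "'a set" and p :: "'a \<Rightarrow> nat" and G :: "'a pair_pre_digraph"
    and k :: nat and A :: "'a set"
  assumes G_graph: "G \<in> graphs_on V"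
    and G_arcs: "parcs G = {(u, v). u \<in> V \<and> v \<in> V \<and> p u \<noteq> p v}"
    and A_def: "A = {v \<in> V. p v = k}"
begin

lemma finite_V: "finite V" and pverts_G: "pverts G = V"
  using graphs_onD[OF G_graph] by auto

lemma A_subset: "A \<subseteq> V" and finite_A: "finite A"
  using finite_V by (auto simp: A_def)

lemma neighborhood_G: "v \<in> V \<Longrightarrow> neighborhood G v = {u \<in> V. p u \<noteq> p v}"
  unfolding neighborhood_def G_arcs by auto

lemma neighborhood_part: "v \<in> A \<Longrightarrow> neighborhood G v = V - A"
  by (auto simp: neighborhood_G A_def)

lemma part_subset_neighborhood: "v \<in> V - A \<Longrightarrow> A \<subseteq> neighborhood G v"
  by (auto simp: neighborhood_G A_def)

text \<open>On \<open>A\<close>, all lists are equal to \<open>V - A\<close>.\<close>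

lemma hall_ratio_le_if_hall_condition:
  assumes H: "H \<in> graphs_on V" and hall: "graph_hall_condition H G"
  shows "hall_ratio_le (parcs H) A (card (V - A))"
  unfolding hall_ratio_le_def
proof (intro allI impI)
  fix F assume F: "F \<subseteq> A"
  then have finF: "finite F"
    using finite_A finite_subset by blast
  define K where "K = \<lparr> pverts = F, parcs = parcs H \<inter> F \<times> F \<rparr>"
  have "pair_graph K \<and> subgraph (with_proj K) (with_proj H)"
    unfolding K_def using F A_subset by (intro induced_subgraph_of_graph[OF H]) auto
  then have sum: "card F \<le> (\<Sum>\<sigma>\<in>V. hall_alpha K (neighborhood G) \<sigma>)"
    using hall unfolding graph_hall_condition_def hall_condition_def pverts_G by (auto simp: K_def)
  have indep: "independent_set K X \<longleftrightarrow> X \<subseteq> F \<and> stable_set (parcs H) X" for X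
    unfolding independent_set_def stable_set_def K_def by auto
  define \<S> where "\<S> = {X. X \<subseteq> F \<and> stable_set (parcs H) X}"
  have "finite \<S>"
    unfolding \<S>_def using finF by simp
  moreover have "{} \<in> \<S>"
    unfolding \<S>_def stable_set_def by simp
  ultimately obtain X where X: "X \<in> \<S>" and "card X = Max (card ` \<S>)"
    by (metis (no_types, lifting) Max_in empty_iff finite_imageI image_iff image_is_empty)
  then have max: "card Y \<le> card X" if "Y \<in> \<S>" for Y
    using that \<open>finite \<S>\<close> by simp
  have "hall_alpha K (neighborhood G) \<sigma> \<le> (if \<sigma> \<in> V - A then card X else 0)" if "\<sigma> \<in> V" for \<sigma>
  proof (rule hall_alpha_le)
    show "finite (pverts K)"
      using finF by (simp add: K_def)
    fix Y assume Y: "independent_set K Y" "\<forall>v\<in>Y. \<sigma> \<in> neighborhood G v"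
    have "Y = {}" if "\<sigma> \<in> A"
      using Y that F indep neighborhood_part by blast
    with Y(1) max[of Y] that show "card Y \<le> (if \<sigma> \<in> V - A then card X else 0)"
      by (auto simp: indep \<S>_def)
  qed
  then have "(\<Sum>\<sigma>\<in>V. hall_alpha K (neighborhood G) \<sigma>) \<le> (\<Sum>\<sigma>\<in>V. if \<sigma> \<in> V - A then card X else 0)"
    by (rule sum_mono)
  also have "\<dots> = (\<Sum>\<sigma>\<in>V - A. card X)"
    using finite_V by (intro sum.mono_neutral_cong_right) auto
  finally show "\<exists>X\<subseteq>F. stable_set (parcs H) X \<and> card F \<le> card (V - A) * card X"
    using sum X unfolding \<S>_def by auto
qed

text \<open>A subgraph with vertex set \<open>Q\<close> has enough colors: those in \<open>V - A\<close> account for \<open>Q \<inter> A\<close>, and since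
  \<open>Q - A\<close> is independent, each color in \<open>A\<close> accounts for all of \<open>Q - A\<close>.\<close>

lemma hall_condition_if_hall_ratio_le:
  assumes H: "H \<in> graphs_on V" and arcs: "parcs H \<subseteq> A \<times> A" and "A \<noteq> {}"
    and ratio: "hall_ratio_le (parcs H) A (card (V - A))"
  shows "graph_hall_condition H G"
  unfolding graph_hall_condition_def hall_condition_def pverts_G
proof (intro allI impI, elim conjE)
  fix F assume sub: "subgraph (with_proj F) (with_proj H)"
  let ?Q = "pverts F"
  let ?\<alpha> = "hall_alpha F (neighborhood G)"
  have Q: "?Q \<subseteq> V"
    using subgraph_with_projD(1)[OF sub] graphs_onD(1)[OF H] by simp
  then have finQ: "finite ?Q"
    using finite_V finite_subset by blast
  obtain X where X: "X \<subseteq> ?Q \<inter> A" "stable_set (parcs H) X" "card (?Q \<inter> A) \<le> card (V - A) * card X"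
    using ratio unfolding hall_ratio_le_def by (meson Int_lower2)
  have "card X \<le> ?\<alpha> \<sigma>" if "\<sigma> \<in> V - A" for \<sigma>
  proof (rule hall_alpha_ge[OF finQ])
    show "independent_set F X"
      using X(1,2) subgraph_with_projD(2)[OF sub] unfolding independent_set_def stable_set_def by blast
    show "\<forall>v\<in>X. \<sigma> \<in> neighborhood G v"
      using X(1) that neighborhood_part by blast
  qed
  then have B: "card (V - A) * card X \<le> (\<Sum>\<sigma>\<in>V - A. ?\<alpha> \<sigma>)"
    using sum_bounded_below[of "V - A" "card X" ?\<alpha>] by simp
  have "card (?Q - A) \<le> ?\<alpha> \<sigma>" if "\<sigma> \<in> A" for \<sigma>
  proof (rule hall_alpha_ge[OF finQ])
    show "independent_set F (?Q - A)"
      using arcs subgraph_with_projD(2)[OF sub] unfolding independent_set_def by blast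
    show "\<forall>v\<in>?Q - A. \<sigma> \<in> neighborhood G v"
      using Q that part_subset_neighborhood by blast
  qed
  then have "card A * card (?Q - A) \<le> (\<Sum>\<sigma>\<in>A. ?\<alpha> \<sigma>)"
    using sum_bounded_below[of A "card (?Q - A)" ?\<alpha>] by simp
  moreover have "card (?Q - A) \<le> card A * card (?Q - A)"
    using assms(3) finite_A by (simp add: Suc_le_eq card_gt_0_iff)
  ultimately have "card ?Q \<le> (\<Sum>\<sigma>\<in>A. ?\<alpha> \<sigma>) + (\<Sum>\<sigma>\<in>V - A. ?\<alpha> \<sigma>)"
    using B X(3) card_Int_Diff[OF finQ, of A] by linarith
  also have "\<dots> = (\<Sum>\<sigma>\<in>V. ?\<alpha> \<sigma>)"
    using sum.subset_diff[OF A_subset finite_V, of ?\<alpha>] by simp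
  finally show "card ?Q \<le> (\<Sum>\<sigma>\<in>V. ?\<alpha> \<sigma>)" .
qed

lemma k_colorable_if_graph_colorable:
  assumes H: "H \<in> graphs_on V" and "graph_colorable H G"
  shows "k_colorable (parcs H) A (card (V - A))"
proof -
  obtain \<phi> where \<phi>: "\<forall>v\<in>V. \<phi> v \<in> neighborhood G v" "\<forall>(u, v)\<in>parcs H. \<phi> u \<noteq> \<phi> v"
    using assms(2) graphs_onD(1)[OF H]
    unfolding graph_colorable_def list_colorable_def by auto
  have "\<phi> ` A \<subseteq> V - A"
    using \<phi>(1) neighborhood_part A_subset by blast
  then have "card (\<phi> ` A) \<le> card (V - A)"
    using finite_V by (intro card_mono) auto
  with \<phi>(2) finite_A show ?thesis
    by (intro k_colorableI[where c = \<phi>]) auto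
qed

text \<open>The vertices outside \<open>A\<close> receive distinct colors from \<open>A\<close>.\<close>

lemma graph_colorable_if_k_colorable:
  assumes H: "H \<in> graphs_on V" and large: "card (V - A) \<le> card A"
    and "k_colorable (parcs H) A (card (V - A))"
  shows "graph_colorable H G"
proof -
  obtain c :: "'a \<Rightarrow> nat" where c: "c ` A \<subseteq> {..<card (V - A)}"
      "\<forall>u\<in>A. \<forall>v\<in>A. (u, v) \<in> parcs H \<longrightarrow> c u \<noteq> c v"
    using assms(3) unfolding k_colorable_def by blast
  obtain e where e: "bij_betw e {..<card (V - A)} (V - A)"
    using finite_V by (metis atLeast0LessThan ex_bij_betw_nat_finite finite_Diff)
  obtain g where g: "g ` (V - A) \<subseteq> A" "inj_on g (V - A)"
    using large finite_V finite_A card_le_inj[of "V - A" A] by auto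
  define \<phi> where "\<phi> v = (if v \<in> A then e (c v) else g v)" for v
  have color_A: "\<phi> v \<in> V - A" if "v \<in> A" for v
    using that c(1) bij_betwE[OF e] unfolding \<phi>_def by auto
  have color_B: "\<phi> v \<in> A" if "v \<in> V - A" for v
    using that g(1) unfolding \<phi>_def by auto
  have lists: "\<phi> v \<in> neighborhood G v" if "v \<in> V" for v
    using that color_A color_B neighborhood_part part_subset_neighborhood by blast
  have "\<phi> u \<noteq> \<phi> v" if uv: "(u, v) \<in> parcs H" for u v
  proof -
    have V: "u \<in> V" "v \<in> V" "u \<noteq> v"
      using uv graphs_onD(3,5)[OF H] unfolding irrefl_def by auto
    consider "u \<in> A" "v \<in> A" | "u \<in> A" "v \<in> V - A" | "u \<in> V - A" "v \<in> A" | "u \<in> V - A" "v \<in> V - A"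
      using V by blast
    then show ?thesis
    proof cases
      case 1
      then have "c u \<noteq> c v" "c u < card (V - A)" "c v < card (V - A)"
        using c uv by auto
      with 1 bij_betw_imp_inj_on[OF e] show ?thesis
        unfolding \<phi>_def by (auto dest: inj_onD)
    next
      case 4
      with g(2) V(3) show ?thesis
        unfolding \<phi>_def by (auto dest: inj_onD)
    qed (use color_A color_B in \<open>metis DiffD2\<close>)+
  qed
  moreover have "\<phi> \<in> V \<rightarrow> V"
    using color_A color_B A_subset by blast
  ultimately show ?thesis
    using lists graphs_onD(1)[OF H]
    unfolding graph_colorable_def list_colorable_def pverts_G by (intro bexI[of _ \<phi>]) auto
qed

end

text \<open>List the vertices part by part and shift cyclically by \<open>m\<close>, an upper bound for the sizes of the
  parts: since every part is an interval of at most \<open>m \<le> n - m\<close> positions, each vertex moves to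
  another part.\<close>

lemma ex_derangement_of_parts:
  fixes p :: "'a \<Rightarrow> nat"
  assumes "finite V" and parts: "\<And>i. card {v \<in> V. p v = i} \<le> m" and "2 * m \<le> card V"
  obtains f where "f \<in> V \<rightarrow> V" "inj_on f V" "\<And>v. v \<in> V \<Longrightarrow> p (f v) \<noteq> p v"
proof -
  obtain ys where ys: "set ys = V" "distinct ys"
    using assms(1) finite_distinct_list by blast
  define xs where "xs = sort_key p ys"
  have xs: "set xs = V" "distinct xs" "sorted (map p xs)"
    using ys unfolding xs_def by auto
  let ?n = "length xs"
  have n: "?n = card V"
    using xs distinct_card by metis
  have apart: "p (xs ! i) \<noteq> p (xs ! j)" if ij: "i + m \<le> j" "j < ?n" for i j
  proof
    assume eq: "p (xs ! i) = p (xs ! j)"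
    have "p (xs ! l) = p (xs ! i)" if "l \<in> {i..j}" for l
    proof (rule order_antisym)
      show "p (xs ! i) \<le> p (xs ! l)"
        using that ij sorted_nth_mono[OF xs(3), of i l] by simp
      have "p (xs ! l) \<le> p (xs ! j)"
        using that ij sorted_nth_mono[OF xs(3), of l j] by simp
      then show "p (xs ! l) \<le> p (xs ! i)"
        by (simp only: eq)
    qed
    moreover have "(!) xs ` {i..j} \<subseteq> V"
      using ij xs(1) by auto
    ultimately have "(!) xs ` {i..j} \<subseteq> {v \<in> V. p v = p (xs ! i)}"
      by blast
    then have "card ((!) xs ` {i..j}) \<le> card {v \<in> V. p v = p (xs ! i)}"
      using assms(1) by (intro card_mono) auto
    also have "\<dots> \<le> m"
      by (rule parts)
    finally have "card ((!) xs ` {i..j}) \<le> m" .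
    moreover have "inj_on ((!) xs) {i..j}"
      using xs(2) ij by (intro inj_on_nth) auto
    ultimately show False
      using ij by (simp add: card_image)
  qed
  define s where "s i = (if i + m < ?n then i + m else i + m - ?n)" for i
  have s: "s i < ?n" if "i < ?n" for i
    using that assms(3) n unfolding s_def by auto
  have s_inj: "inj_on s {..<?n}"
    by (rule inj_onI) (auto simp: s_def split: if_splits)
  have moved: "p (xs ! s i) \<noteq> p (xs ! i)" if "i < ?n" for i
  proof (cases "i + m < ?n")
    case True
    then show ?thesis
      using apart[of i "i + m"] unfolding s_def by auto
  next
    case False
    then show ?thesis
      using apart[of "i + m - ?n" i] that assms(3) n unfolding s_def by auto
  qed
  have bij: "bij_betw ((!) xs) {..<?n} V"
    using bij_betw_nth[OF xs(2) refl] xs(1) by auto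
  define pos where "pos = inv_into {..<?n} ((!) xs)"
  have pos: "pos v < ?n" "xs ! pos v = v" if "v \<in> V" for v
    using bij that unfolding pos_def bij_betw_def
    by (metis inv_into_into lessThan_iff, metis f_inv_into_f)
  define f where "f v = xs ! s (pos v)" for v
  have "f \<in> V \<rightarrow> V"
    using s pos xs(1) unfolding f_def by auto
  moreover have "inj_on f V"
  proof (rule inj_onI)
    fix u v assume uv: "u \<in> V" "v \<in> V" "f u = f v"
    then have "s (pos u) = s (pos v)"
      using nth_eq_iff_index_eq[OF xs(2)] s pos unfolding f_def by auto
    then have "pos u = pos v"
      using s_inj pos uv by (auto dest: inj_onD)
    then show "u = v"
      using pos uv by metis
  qed
  moreover have "p (f v) \<noteq> p v" if "v \<in> V" for v
    using moved[OF pos(1)[OF that]] pos(2)[OF that] unfolding f_def by simp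
  ultimately show ?thesis by (rule that)
qed

text \<open>Injective colorings are proper for every graph \<open>H\<close>.\<close>

lemma (in multipartite_part) graph_colorable_if_no_large_part:
  assumes H: "H \<in> graphs_on V"
    and "\<And>i. card {v \<in> V. p v = i} \<le> card A" and "2 * card A \<le> card V"
  shows "graph_colorable H G"
proof -
  obtain f where f: "f \<in> V \<rightarrow> V" "inj_on f V" "\<And>v. v \<in> V \<Longrightarrow> p (f v) \<noteq> p v"
    using ex_derangement_of_parts[OF finite_V assms(2,3)] by blast
  have "\<forall>v\<in>V. f v \<in> neighborhood G v"
    using f(1,3) neighborhood_G by auto
  moreover have "f u \<noteq> f v" if "(u, v) \<in> parcs H" for u v
    using that f(2) graphs_onD(3,5)[OF H] unfolding irrefl_def by (auto dest: inj_onD)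
  ultimately show ?thesis
    using f(1) graphs_onD(1)[OF H]
    unfolding graph_colorable_def list_colorable_def pverts_G by (intro bexI[of _ f]) auto
qed

lemma (in multipartite_part) hall_universal_iff:
  assumes "\<And>i. card {v \<in> V. p v = i} \<le> card A" and "V - A \<noteq> {}"
  shows "hall_universal G \<longleftrightarrow> card (V - A) \<le> 2 \<or> card A \<le> card (V - A) + 2"
proof -
  have Vcard: "card V = card A + card (V - A)"
    using finite_V A_subset by (metis Int_absorb1 card_Int_Diff inf_commute)
  have bpos: "0 < card (V - A)"
    using assms(2) finite_V by (simp add: card_gt_0_iff)
  show ?thesis
  proof
    assume rhs: "card (V - A) \<le> 2 \<or> card A \<le> card (V - A) + 2"
    show "hall_universal G"
      unfolding hall_universal_def pverts_G
    proof (intro ballI impI)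
      fix H assume H: "H \<in> graphs_on V" and hall: "graph_hall_condition H G"
      show "graph_colorable H G"
      proof (cases "card A \<le> card (V - A)")
        case True
        then show ?thesis
          using graph_colorable_if_no_large_part[OF H assms(1)] Vcard by simp
      next
        case False
        have "k_colorable (parcs H) A (card (V - A))"
          using k_colorable_if_hall_ratio_le[OF finite_A graphs_onD(4,5)[OF H]
              hall_ratio_le_if_hall_condition[OF H hall] bpos rhs] .
        then show ?thesis
          using graph_colorable_if_k_colorable[OF H] False by simp
      qed
    qed
  next
    assume universal: "hall_universal G"
    show "card (V - A) \<le> 2 \<or> card A \<le> card (V - A) + 2"
    proof (rule ccontr)
      assume "\<not> ?thesis"
      then have "3 \<le> card (V - A)" "card (V - A) + 3 \<le> card A"
        by auto
      then obtain E where E: "E \<subseteq> A \<times> A" "sym E" "irrefl E" "hall_ratio_le E A (card (V - A))"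
          "\<not> k_colorable E A (card (V - A))"
        using ex_hall_ratio_le_not_colorable[OF finite_A] by blast
      define H where "H = \<lparr> pverts = V, parcs = E \<rparr>"
      have H: "H \<in> graphs_on V"
        unfolding H_def using E A_subset finite_V by (intro graphs_onI) auto
      have "A \<noteq> {}"
        using \<open>card (V - A) + 3 \<le> card A\<close> by auto
      then have "graph_hall_condition H G"
        using hall_condition_if_hall_ratio_le[OF H] E by (simp add: H_def)
      then have "graph_colorable H G"
        using universal H unfolding hall_universal_def pverts_G by blast
      then have "k_colorable E A (card (V - A))"
        using k_colorable_if_graph_colorable[OF H] by (simp add: H_def)
      with E(5) show False by blast
    qed
  qed
qed

section \<open>The classification\<close>

lemma digraph_iso_with_projE:
  assumes "digraph_iso (with_proj G) (with_proj K)" and "G \<in> graphs_on V"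
  obtains h where "bij_betw h V (pverts K)"
    "\<And>u v. u \<in> V \<Longrightarrow> v \<in> V \<Longrightarrow> (u, v) \<in> parcs G \<longleftrightarrow> (h u, h v) \<in> parcs K"
proof -
  note G = graphs_onD[OF assms(2)]
  obtain f where iso: "pre_digraph.digraph_isomorphism (with_proj G) f"
    and K: "with_proj K = app_iso f (with_proj G)"
    using assms(1) unfolding digraph_iso_def by blast
  let ?h = "iso_verts f"
  have inj: "inj_on ?h V"
    and ends: "\<And>a. a \<in> parcs G \<Longrightarrow> ?h (fst a) = iso_tail f (iso_arcs f a)
      \<and> ?h (snd a) = iso_head f (iso_arcs f a)"
    using iso G(1) unfolding pre_digraph.digraph_isomorphism_def by auto
  have "verts (with_proj K) = ?h ` V" "arcs (with_proj K) = iso_arcs f ` parcs G"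
      "tail (with_proj K) = iso_tail f" "head (with_proj K) = iso_head f"
    unfolding K using G(1) by simp_all
  then have verts: "pverts K = ?h ` V" and arcs: "parcs K = iso_arcs f ` parcs G"
    and tail: "iso_tail f = fst" and head: "iso_head f = snd"
    by simp_all
  have arc: "iso_arcs f a = (?h (fst a), ?h (snd a))" if "a \<in> parcs G" for a
    using ends[OF that] tail head by simp
  have "(u, v) \<in> parcs G \<longleftrightarrow> (?h u, ?h v) \<in> parcs K" if uv: "u \<in> V" "v \<in> V" for u v
  proof
    assume "(u, v) \<in> parcs G"
    then show "(?h u, ?h v) \<in> parcs K"
      unfolding arcs using arc by force
  next
    assume "(?h u, ?h v) \<in> parcs K"
    then obtain a b where ab: "(a, b) \<in> parcs G" "?h u = ?h a" "?h v = ?h b"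
      unfolding arcs using arc by fastforce
    then have "a = u" "b = v"
      using inj uv G(3) by (auto dest: inj_onD)
    with ab(1) show "(u, v) \<in> parcs G" by simp
  qed
  moreover have "bij_betw ?h V (pverts K)"
    using inj verts unfolding bij_betw_def by simp
  ultimately show ?thesis
    using that by blast
qed

theorem theorem4p15:
  fixes V :: "'a set" and A :: "nat \<Rightarrow> 'a set" and r :: nat and G :: "'a pair_pre_digraph"
  assumes "r \<ge> 2"
    and "finite V"
    and "V = (\<Union>i\<in>{1..r}. A i)"
    and "disjoint_family_on A {1..r}"
    and "\<forall>i\<in>{1..r}. A i \<noteq> {}"
    and "G \<in> graphs_on V"
    and "digraph_iso (with_proj G) (with_proj (complete_multipartite {1..r} A))"
  shows "hall_universal G \<longleftrightarrow>
    int (card V) - int (MAX i\<in>{1..r}. card (A i)) \<le> 2 \<or>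
    2 * int (MAX i\<in>{1..r}. card (A i)) - int (card V) \<le> 2"
proof -
  let ?K = "complete_multipartite {1..r} A"
  let ?M = "MAX i\<in>{1..r}. card (A i)"
  obtain h where h: "bij_betw h V (pverts ?K)"
    and adj: "\<And>u v. u \<in> V \<Longrightarrow> v \<in> V \<Longrightarrow> (u, v) \<in> parcs G \<longleftrightarrow> (h u, h v) \<in> parcs ?K"
    using digraph_iso_with_projE[OF assms(7,6)] by blast
  have hV: "bij_betw h V V"
    using h assms(3) by (simp add: complete_multipartite_def)
  \<comment> \<open>The parts of \<open>G\<close> are the preimages of the sets \<open>A i\<close> under the isomorphism.\<close>
  define p where "p v = (THE i. i \<in> {1..r} \<and> h v \<in> A i)" for v
  have p_eq: "p v = i" if "i \<in> {1..r}" "h v \<in> A i" for v i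
    unfolding p_def
  proof (rule the_equality)
    show "j = i" if "j \<in> {1..r} \<and> h v \<in> A j" for j
      using that \<open>i \<in> {1..r}\<close> \<open>h v \<in> A i\<close> disjoint_family_onD[OF assms(4), of j i] by blast
  qed (use that in blast)
  have p: "p v \<in> {1..r} \<and> h v \<in> A (p v)" if "v \<in> V" for v
  proof -
    have "h v \<in> V"
      using that bij_betwE[OF hV] by blast
    then obtain i where "i \<in> {1..r}" "h v \<in> A i"
      using assms(3) by blast
    then show ?thesis
      using p_eq[of i v] by simp
  qed
  have K_arcs: "(h u, h v) \<in> parcs ?K \<longleftrightarrow> p u \<noteq> p v" if "u \<in> V" "v \<in> V" for u v
  proof
    assume "(h u, h v) \<in> parcs ?K"
    then obtain i j where "i \<in> {1..r}" "j \<in> {1..r}" "i \<noteq> j" "h u \<in> A i" "h v \<in> A j"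
      unfolding complete_multipartite_def by auto
    with p_eq[of i u] p_eq[of j v] show "p u \<noteq> p v" by simp
  next
    assume "p u \<noteq> p v"
    with p[OF that(1)] p[OF that(2)] show "(h u, h v) \<in> parcs ?K"
      unfolding complete_multipartite_def pair_pre_digraph.simps by blast
  qed
  have G_arcs: "parcs G = {(u, v). u \<in> V \<and> v \<in> V \<and> p u \<noteq> p v}"
    using graphs_onD(3)[OF assms(6)] adj K_arcs by blast
  have part: "card {v \<in> V. p v = i} = card (A i)" if i: "i \<in> {1..r}" for i
  proof -
    have "h ` {v \<in> V. p v = i} = A i"
    proof
      show "h ` {v \<in> V. p v = i} \<subseteq> A i"
        using p by auto
      show "A i \<subseteq> h ` {v \<in> V. p v = i}"
      proof
        fix x assume x: "x \<in> A i"
        then have "x \<in> h ` V"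
          using i assms(3) hV unfolding bij_betw_def by blast
        then obtain v where "v \<in> V" "x = h v" by blast
        with x i p_eq show "x \<in> h ` {v \<in> V. p v = i}" by blast
      qed
    qed
    moreover have "inj_on h {v \<in> V. p v = i}"
      using bij_betw_imp_inj_on[OF hV] by (rule inj_on_subset) auto
    ultimately show ?thesis
      by (metis card_image)
  qed
  have le_M: "card (A i) \<le> ?M" if "i \<in> {1..r}" for i
    using that by (intro Max_ge) auto
  have "?M \<in> (\<lambda>i. card (A i)) ` {1..r}"
    using assms(1) by (intro Max_in) auto
  then obtain k where k: "k \<in> {1..r}" "?M = card (A k)"
    by auto
  define B where "B = {v \<in> V. p v = k}"
  have card_B: "card B = ?M"
    using part[OF k(1)] k(2) unfolding B_def by simp
  interpret multipartite_part V p G k B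
    by unfold_locales (use assms(6) G_arcs B_def in auto)
  have small: "card {v \<in> V. p v = i} \<le> card B" for i
  proof (cases "i \<in> {1..r}")
    case True
    then show ?thesis
      using part le_M card_B by simp
  next
    case False
    then have "{v \<in> V. p v = i} = {}"
      using p by blast
    then show ?thesis
      by (simp only: card.empty)
  qed
  \<comment> \<open>As \<open>r \<ge> 2\<close>, there is a second part.\<close>
  define j where "j = (if k = 1 then 2 else 1 :: nat)"
  have j: "j \<in> {1..r}" "j \<noteq> k"
    using assms(1) unfolding j_def by auto
  have "finite (A j)"
    using j(1) assms(2,3) by (intro finite_subset[of "A j" V]) blast+
  then have "card {v \<in> V. p v = j} \<noteq> 0"
    using part[OF j(1)] assms(5) j(1) by simp
  then obtain v where "v \<in> V" "p v = j"
    by (metis (mono_tags, lifting) card.empty empty_Collect_eq)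
  then have rest: "V - B \<noteq> {}"
    using j(2) unfolding B_def by blast
  have "card V = card B + card (V - B)"
    using finite_V A_subset by (metis Int_absorb1 card_Int_Diff inf_commute)
  with hall_universal_iff[OF small rest] card_B show ?thesis
    by linarith
qed

end
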